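(* For any $t \in (0,1)$ and $\chi \in \mathbb{R}_{>0}$, the $\chi^{-1}t^{\mathbb{Z}}$-valued random variable $\chi^{-1}t^{-\mathcal{L}_{t,\chi}^{(1)}}$ has moments $$\mathbb{E}\left[\left(\chi^{-1}t^{-\mathcal{L}_{t,\chi}^{(1)}}\right)^m\right] = \frac{t^{-\binom{m+1}{2}}(t;t)_m}{m!}$$ for each $m \in \mathbb{Z}_{\geq 0}$.
   Context: $(a;t)_n = \prod_{i=1}^n(1-at^{i-1})$ for $n \in \mathbb{Z}_{\ge0}\cup\{\infty\}$. $\mathcal{L}^{(1)}_{t,\chi}$ is the $\mathbb{Z}$-valued random variable with $$\Pr(\mathcal{L}_{t,\chi}^{(1)} = L) = \frac{1}{(t;t)_\infty} \sum_{m \geq 0} e^{-\chi t^{L-m}} \frac{(-1)^m t^{\binom{m}{2}}}{(t;t)_m} = \frac{1}{2\pi\mathbf{i}}\int_{\tilde\Gamma}\frac{e^{\chi t^L w}}{(-w;t)_\infty}\,dw, \qquad L \in \mathbb{Z},$$ where $\mathbf{i}=\sqrt{-1}$ and $\tilde\Gamma = \{x+\mathbf{i}: x\le0\}\cup\{x-\mathbf{i}:x\le0\}\cup\{x+\mathbf{i}y: x^2+y^2=1,x>0\}$, oriented counterclockwise (from $-\infty-\mathbf{i}$ to $-\infty+\mathbf{i}$). (It is known that these two expressions agree and define a probability distribution on $\mathbb{Z}$.) *)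

theory Defs
  imports "HOL-Probability.Probability"
begin

definition qpochhammer :: "real \<Rightarrow> real \<Rightarrow> enat \<Rightarrow> real"
  where "qpochhammer a t n =
    (case n of
      enat k \<Rightarrow> (\<Prod>i=1..k. 1 - a * t ^ (i - 1))
    | \<infinity> \<Rightarrow> (\<Prod>i. 1 - a * t ^ i))"

text \<open>
  The probability that the integer-valued random variable with parameters \<open>t\<close> and
  \<open>chi\<close> takes the value \<open>l\<close>.  For \<open>0 < t < 1\<close> and \<open>chi > 0\<close> these numbers
  are known to form a probability distribution on the integers.
\<close>
definition limit_prob :: "real \<Rightarrow> real \<Rightarrow> int \<Rightarrow> real"
  where "limit_prob t chi l =
    1 / qpochhammer t t \<infinity> *
    (\<Sum>m. exp (- chi * t powi (l - int m)) *
      ((- 1) ^ m * t ^ (m choose 2) / qpochhammer t t (enat m)))"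

definition has_limit_law :: "'a measure \<Rightarrow> ('a \<Rightarrow> int) \<Rightarrow> real \<Rightarrow> real \<Rightarrow> bool"
  where "has_limit_law M L t chi \<longleftrightarrow>
    prob_space M \<and>
    L \<in> measurable M (count_space UNIV) \<and>
    (\<forall>l. measure M {\<omega> \<in> space M. L \<omega> = l} = limit_prob t chi l)"

end

theory Submission
  imports Defs
begin

text \<open>
  Put \<open>g(x) = (\<Sum>j. c\<^sub>j exp (- x / t^j))\<close>, where \<open>c\<^sub>j\<close> are the Taylor coefficients of
  \<open>(z;t)\<^sub>\<infinity>\<close>, so that the law at \<open>l\<close> is \<open>g(chi t^l) / (t;t)\<^sub>\<infinity>\<close>.  The recursion for \<open>c\<^sub>j\<close> gives
  \<open>g(0) = (1;t)\<^sub>\<infinity> = 0\<close> and the pantograph equation \<open>g'(x) = g(x / t) / t - g(x)\<close>, hence \<open>g\<close> decays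
  faster than any power of \<open>x\<close> at \<open>0\<close> and at infinity.  Therefore
  \<open>S\<^sub>m(x) = (\<Sum>l. (x t^l)^(-m) g(x t^l))\<close>, summed over all integers \<open>l\<close>, converges for every integer
  \<open>m\<close>, is invariant under \<open>x \<mapsto> x / t\<close>, and satisfies
  \<open>x S\<^sub>m'(x) = - m S\<^sub>m(x) + (t^(-m) - 1) S\<^sub>m\<^sub>-\<^sub>1(x)\<close>.  So \<open>S\<^sub>0\<close> is constant, and inductively
  \<open>S\<^sub>m = (t^(-m) - 1) / m S\<^sub>m\<^sub>-\<^sub>1\<close>.  The total mass \<open>1\<close> fixes the normalisation.
\<close>

section \<open>Sums over the integers\<close>

text \<open>This two-sided geometric series is the common majorant for the sums over the integers
  below.\<close>

lemma summable_on_int_power_abs: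
  fixes t :: real
  assumes "0 < t" "t < 1"
  shows "(\<lambda>l. t ^ nat \<bar>l\<bar>) summable_on (UNIV :: int set)"
proof -
  have s: "(\<lambda>n. t ^ n) summable_on (UNIV :: nat set)"
    using assms by (intro norm_summable_imp_summable_on) (simp add: summable_geometric)
  have 1: "(\<lambda>l. t ^ nat \<bar>l\<bar>) summable_on {0::int..}"
    using s summable_on_reindex_bij_witness[of "{0::int..}" int nat UNIV "\<lambda>n. t ^ n"
        "\<lambda>l. t ^ nat \<bar>l\<bar>"] by auto
  have "(\<lambda>n. t ^ n) summable_on {1::nat..}"
    using s by (rule summable_on_subset_banach) auto
  then have 2: "(\<lambda>l. t ^ nat \<bar>l\<bar>) summable_on {..< 0::int}"
    using summable_on_reindex_bij_witness[of "{..<0::int}" "\<lambda>n. - int n" "\<lambda>l. nat (- l)"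
        "{1..}" "\<lambda>n. t ^ n" "\<lambda>l. t ^ nat \<bar>l\<bar>"] by auto
  have "{0::int..} \<union> {..<0} = UNIV" "{0::int..} \<inter> {..<0} = {}" by auto
  with summable_on_Un_disjoint[OF 1 2] show ?thesis by auto
qed

text \<open>The bijection \<open>int_decode\<close> turns an unordered sum into a series over the
  naturals, where termwise differentiation is available.\<close>

lemma summable_on_int_decode:
  fixes f :: "int \<Rightarrow> real"
  assumes "f summable_on UNIV"
  shows "summable (\<lambda>n. f (int_decode n))" "(\<Sum>n. f (int_decode n)) = infsum f UNIV"
proof -
  have "((\<lambda>n. f (int_decode n)) has_sum infsum f UNIV) UNIV"
    using has_sum_infsum[OF assms] has_sum_reindex_bij_betw[OF bij_int_decode] by blast
  then have "(\<lambda>n. f (int_decode n)) sums infsum f UNIV" by (rule has_sum_imp_sums)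
  then show "summable (\<lambda>n. f (int_decode n))" "(\<Sum>n. f (int_decode n)) = infsum f UNIV"
    by (auto simp: sums_iff)
qed

text \<open>The majorant \<open>B\<close> makes the differentiated series converge uniformly on
  \<open>S\<close> (Weierstrass test), so differentiation passes through the sum.\<close>

lemma has_field_derivative_infsum_int:
  fixes f f' :: "int \<Rightarrow> real \<Rightarrow> real"
  assumes S: "convex S" "open S" "x \<in> S"
    and der: "\<And>l y. y \<in> S \<Longrightarrow> (f l has_field_derivative f' l y) (at y)"
    and bound: "\<And>l y. y \<in> S \<Longrightarrow> \<bar>f' l y\<bar> \<le> B l" "B summable_on UNIV"
    and sf: "\<And>y. y \<in> S \<Longrightarrow> (\<lambda>l. f l y) summable_on UNIV"
  shows "((\<lambda>y. \<Sum>\<^sub>\<infinity>l. f l y) has_field_derivative (\<Sum>\<^sub>\<infinity>l. f' l x)) (at x)"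
proof -
  have *: "((\<lambda>y. \<Sum>n. f (int_decode n) y) has_field_derivative (\<Sum>n. f' (int_decode n) x)) (at x)"
  proof (rule has_field_derivative_series'(2)[OF S(1)])
    show "(f (int_decode n) has_field_derivative f' (int_decode n) y) (at y within S)"
      if "y \<in> S" for n y
      using der[OF that] by (rule has_field_derivative_at_within)
    show "uniformly_convergent_on S (\<lambda>n y. \<Sum>i<n. f' (int_decode i) y)"
      using summable_on_int_decode(1)[OF bound(2)] bound(1)
      by (intro Weierstrass_m_test') auto
    show "summable (\<lambda>n. f (int_decode n) x)"
      by (rule summable_on_int_decode(1)[OF sf[OF S(3)]])
  qed (use S in \<open>auto simp: interior_open\<close>)
  have "(\<lambda>l. f' l x) summable_on UNIV"
    by (rule abs_summable_summable[OF Infinite_Sum.abs_summable_on_comparison_test'[OF bound(2)]])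
      (use bound(1)[OF S(3)] in simp)
  then have "(\<Sum>n. f' (int_decode n) x) = (\<Sum>\<^sub>\<infinity>l. f' l x)"
    by (rule summable_on_int_decode(2))
  with * have "((\<lambda>y. \<Sum>n. f (int_decode n) y) has_field_derivative (\<Sum>\<^sub>\<infinity>l. f' l x)) (at x)"
    by simp
  then show ?thesis
    by (rule has_field_derivative_transform_within_open[OF _ S(2,3)])
      (simp add: summable_on_int_decode(2)[OF sf])
qed

section \<open>Expectations of functions of an integer-valued random variable\<close>

lemma distr_int_eq_density:
  fixes L :: "'a \<Rightarrow> int"
  assumes "prob_space M" and L: "L \<in> measurable M (count_space UNIV)"
  shows "distr M (count_space UNIV) L =
    density (count_space UNIV) (\<lambda>l. ennreal (measure M {\<omega> \<in> space M. L \<omega> = l}))"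
proof -
  interpret prob_space M by fact
  show ?thesis
  proof (rule measure_eqI_countable[where A = UNIV])
    fix l :: int
    have "emeasure (distr M (count_space UNIV) L) {l} = emeasure M {\<omega> \<in> space M. L \<omega> = l}"
      using L by (subst emeasure_distr) (auto intro!: arg_cong[where f = "emeasure M"])
    then show "emeasure (distr M (count_space UNIV) L) {l} =
        emeasure (density (count_space UNIV) (\<lambda>l. ennreal (measure M {\<omega> \<in> space M. L \<omega> = l}))) {l}"
      by (subst emeasure_density) (auto simp: emeasure_eq_measure nn_integral_count_space_indicator
          simp flip: nn_integral_count_space_indicator)
  qed auto
qed

text \<open>The law of \<open>L\<close> has density \<open>p\<close> against counting measure, so
  absolute summability of \<open>p l * w l\<close> is exactly integrability of \<open>w\<close>
  under that law.\<close>

lemma integral_int_valued: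
  fixes L :: "'a \<Rightarrow> int" and w :: "int \<Rightarrow> real"
  assumes "prob_space M" and L: "L \<in> measurable M (count_space UNIV)"
    and p: "\<And>l. measure M {\<omega> \<in> space M. L \<omega> = l} = p l"
    and abs: "(\<lambda>l. \<bar>p l * w l\<bar>) summable_on UNIV"
  shows "integrable M (\<lambda>\<omega>. w (L \<omega>))" "(\<integral>\<omega>. w (L \<omega>) \<partial>M) = (\<Sum>\<^sub>\<infinity>l. p l * w l)"
proof -
  have nn: "p l \<ge> 0" for l using measure_nonneg p by metis
  have d: "distr M (count_space UNIV) L = density (count_space UNIV) (\<lambda>l. ennreal (p l))"
    using distr_int_eq_density[OF assms(1,2)] by (simp add: p)
  note abs' = abs_summable_equivalent[THEN iffD1, OF abs[folded real_norm_def]]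
  from abs' have "integrable (density (count_space UNIV) (\<lambda>l. ennreal (p l))) w"
    by (subst integrable_density) (auto simp: nn Infinite_Set_Sum.abs_summable_on_def)
  then have "integrable (distr M (count_space UNIV) L) w" by (simp add: d)
  then show "integrable M (\<lambda>\<omega>. w (L \<omega>))"
    by (subst (asm) integrable_distr_eq[OF L]) auto
  have "(\<integral>\<omega>. w (L \<omega>) \<partial>M) = integral\<^sup>L (distr M (count_space UNIV) L) w"
    by (rule integral_distr[OF L, symmetric]) auto
  also have "\<dots> = (\<integral>l. p l * w l \<partial>count_space UNIV)"
    unfolding d by (subst integral_density) (auto simp: nn)
  also have "\<dots> = (\<Sum>\<^sub>\<infinity>l. p l * w l)"
    using infsetsum_infsum[OF abs'] by (simp add: infsetsum_def)
  finally show "(\<integral>\<omega>. w (L \<omega>) \<partial>M) = (\<Sum>\<^sub>\<infinity>l. p l * w l)" .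
qed

lemma constant_on_pos_reals:
  fixes f :: "real \<Rightarrow> real"
  assumes "\<And>x. x > 0 \<Longrightarrow> (f has_field_derivative 0) (at x)" "x > 0" "y > 0"
  shows "f x = f y"
proof -
  have "\<exists>c. \<forall>x\<in>{0<..}. f x = c"
    by (rule has_field_derivative_zero_constant)
      (use assms(1) in \<open>auto intro: has_field_derivative_at_within\<close>)
  with assms(2,3) show ?thesis by auto
qed

section \<open>The profile function\<close>

definition euler_coeff :: "real \<Rightarrow> nat \<Rightarrow> real"
  where "euler_coeff t j = (- 1) ^ j * t ^ (j choose 2) / qpochhammer t t (enat j)"

definition profile :: "real \<Rightarrow> real \<Rightarrow> real"
  where "profile t x = (\<Sum>j. euler_coeff t j * exp (- (x / t ^ j)))"

text \<open>The index \<open>m\<close> is an integer, not a natural number, because differentiation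
  lowers it by one, also at \<open>m = 0\<close>.\<close>

definition weighted :: "real \<Rightarrow> int \<Rightarrow> real \<Rightarrow> real"
  where "weighted t m x = x powi (- m) * profile t x"

text \<open>At \<open>x = chi\<close> this is the \<open>m\<close>-th moment, up to the factor
  \<open>qpochhammer t t \<infinity>\<close>.\<close>

definition moment_sum :: "real \<Rightarrow> int \<Rightarrow> real \<Rightarrow> real"
  where "moment_sum t m x = (\<Sum>\<^sub>\<infinity>l. weighted t m (x * t powi l))"

lemma limit_prob_eq_profile:
  assumes "t \<noteq> 0"
  shows "limit_prob t chi l = profile t (chi * t powi l) / qpochhammer t t \<infinity>"
proof -
  have "t powi (l - int j) = t powi l / t ^ j" for j
    using assms by (simp add: power_int_diff)
  then show ?thesis
    by (simp add: limit_prob_def profile_def euler_coeff_def mult.commute)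
qed

lemma qpochhammer_Suc:
  "qpochhammer a t (enat (Suc n)) = qpochhammer a t (enat n) * (1 - a * t ^ n)"
  by (simp add: qpochhammer_def)

context
  fixes t :: real
  assumes t: "0 < t" "t < 1"
begin

section \<open>Euler coefficients and the pantograph equation\<close>

lemma qpochhammer_pos: "qpochhammer t t (enat n) > 0"
proof (induction n)
  case (Suc n)
  have "t ^ Suc n < 1" using t by (intro power_Suc_less_one) auto
  with Suc show ?case by (simp add: qpochhammer_Suc)
qed (simp add: qpochhammer_def zero_enat_def)

lemma euler_coeff_0: "euler_coeff t 0 = 1"
  by (simp add: euler_coeff_def qpochhammer_def numeral_2_eq_2)

text \<open>Compare coefficients in \<open>(z;t) = (1 - z) (z t;t)\<close> for the infinite
  products.\<close>

lemma euler_coeff_Suc: "euler_coeff t (Suc j) * (1 - t ^ Suc j) = - (t ^ j * euler_coeff t j)"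
proof -
  have "t ^ Suc j < 1" using t by (intro power_Suc_less_one) auto
  moreover have "Suc j choose 2 = j + (j choose 2)" by (simp add: numeral_2_eq_2)
  ultimately show ?thesis using qpochhammer_pos[of j]
    by (simp add: euler_coeff_def qpochhammer_Suc power_add field_simps)
qed

text \<open>Consecutive terms have ratio at most \<open>t ^ j * r / (1 - t)\<close>, which tends to
  0. The values \<open>r = 1\<close>, \<open>r = t\<close> and \<open>r = 1 / t\<close> are used
  later.\<close>

lemma summable_euler_coeff:
  assumes "r > 0"
  shows "summable (\<lambda>j. \<bar>euler_coeff t j\<bar> * r ^ j)"
proof -
  have "(\<lambda>j. t ^ j * r / (1 - t)) \<longlonglongrightarrow> 0 * r / (1 - t)"
    using t by (intro tendsto_intros LIMSEQ_realpow_zero) auto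
  then have "eventually (\<lambda>j. t ^ j * r / (1 - t) < 1/2) sequentially"
    by (rule order_tendstoD) simp
  then obtain N where N: "\<And>j. j \<ge> N \<Longrightarrow> t ^ j * r / (1 - t) < 1/2"
    by (auto simp: eventually_sequentially)
  show ?thesis
  proof (rule summable_ratio_test[of "1/2" N])
    fix j assume j: "j \<ge> N"
    have le: "t ^ Suc j \<le> t" using t by (simp add: mult_left_le power_le_one)
    have "\<bar>euler_coeff t (Suc j)\<bar> * (1 - t) \<le> \<bar>euler_coeff t (Suc j)\<bar> * (1 - t ^ Suc j)"
      using le by (intro mult_left_mono) auto
    also have "\<dots> = \<bar>euler_coeff t (Suc j) * (1 - t ^ Suc j)\<bar>"
      using le t by (simp only: abs_mult)
    also have "\<dots> = t ^ j * \<bar>euler_coeff t j\<bar>"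
      using t by (simp only: euler_coeff_Suc) (simp add: abs_mult)
    finally have "\<bar>euler_coeff t (Suc j)\<bar> \<le> t ^ j / (1 - t) * \<bar>euler_coeff t j\<bar>"
      using t by (simp add: field_simps)
    then have "\<bar>euler_coeff t (Suc j)\<bar> * r ^ Suc j \<le> t ^ j / (1 - t) * \<bar>euler_coeff t j\<bar> * r ^ Suc j"
      using assms by (intro mult_right_mono) auto
    also have "\<dots> = (t ^ j * r / (1 - t)) * (\<bar>euler_coeff t j\<bar> * r ^ j)" by simp
    also have "\<dots> \<le> 1/2 * (\<bar>euler_coeff t j\<bar> * r ^ j)"
      using N[OF j] assms by (intro mult_right_mono) auto
    finally show "norm (\<bar>euler_coeff t (Suc j)\<bar> * r ^ Suc j) \<le> 1/2 * norm (\<bar>euler_coeff t j\<bar> * r ^ j)"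
      using assms by simp
  qed simp
qed

lemma summable_abs_euler_coeff: "summable (\<lambda>j. \<bar>euler_coeff t j\<bar>)"
  using summable_euler_coeff[of 1] by simp

lemma summable_profile:
  assumes "x \<ge> 0"
  shows "summable (\<lambda>j. \<bar>euler_coeff t j * exp (- (x / t ^ j))\<bar>)"
proof (rule summable_comparison_test'[OF summable_abs_euler_coeff])
  show "norm \<bar>euler_coeff t j * exp (- (x / t ^ j))\<bar> \<le> \<bar>euler_coeff t j\<bar>" for j
    using assms t by (simp add: abs_mult mult_left_le)
qed

text \<open>By the recursion each later coefficient is a difference of consecutive values of
  \<open>?A\<close>; the series telescopes to \<open>- ?A 0 = -1\<close> and cancels the leading
  coefficient 1.\<close>

lemma profile_0: "profile t 0 = 0"
proof -
  let ?A = "\<lambda>j. euler_coeff t j * t ^ j"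
  have "summable ?A"
    using summable_euler_coeff[OF t(1)] t by (intro summable_rabs_cancel[of ?A]) (simp add: abs_mult)
  then have "?A \<longlonglongrightarrow> 0" by (rule summable_LIMSEQ_zero)
  then have "(\<lambda>j. ?A (Suc j) - ?A j) sums (0 - ?A 0)" by (rule telescope_sums)
  moreover have "?A (Suc j) - ?A j = euler_coeff t (Suc j)" for j
    using euler_coeff_Suc[of j] by (simp add: algebra_simps)
  ultimately have "(\<lambda>j. euler_coeff t (Suc j)) sums (- 1)" by (simp add: euler_coeff_0)
  then have "(\<lambda>j. euler_coeff t j) sums (- 1 + euler_coeff t 0)" by (rule sums_Suc)
  then show ?thesis by (simp add: profile_def euler_coeff_0 sums_iff)
qed

text \<open>The derivative is one-sided at 0, so that later bounds can integrate from 0, where the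
  profile vanishes.\<close>

lemma profile_has_derivative:
  assumes "x \<ge> 0"
  shows "(profile t has_field_derivative profile t (x / t) / t - profile t x) (at x within {0..})"
proof -
  let ?f = "\<lambda>j x. euler_coeff t j * exp (- (x / t ^ j))"
  let ?f' = "\<lambda>j x. - (euler_coeff t j / t ^ j * exp (- (x / t ^ j)))"
  have "uniformly_convergent_on {0..} (\<lambda>n x. \<Sum>j<n. ?f' j x)"
  proof (rule Weierstrass_m_test')
    show "norm (?f' j x) \<le> \<bar>euler_coeff t j\<bar> * (1 / t) ^ j" if "x \<in> {0..}" for j x
      using that t by (simp add: abs_mult power_one_over field_simps mult_left_le)
    show "summable (\<lambda>j. \<bar>euler_coeff t j\<bar> * (1 / t) ^ j)"
      using t by (intro summable_euler_coeff) auto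
  qed
  then obtain g' where g': "uniform_limit {0..} (\<lambda>n x. \<Sum>j<n. ?f' j x) g' sequentially"
    unfolding uniformly_convergent_on_def by auto
  have "\<exists>g. \<forall>x\<in>{0..}. (\<lambda>j. ?f j x) sums g x \<and> (g has_field_derivative g' x) (at x within {0..})"
  proof (rule has_field_derivative_series[OF _ _ g'])
    show "(?f j has_field_derivative ?f' j x) (at x within {0..})" for j x
      using t by (auto intro!: derivative_eq_intros)
    show "summable (\<lambda>j. ?f j x)"
      using summable_profile[OF assms] by (rule summable_rabs_cancel)
  qed (use assms in auto)
  then obtain g where g: "\<And>x. x \<ge> 0 \<Longrightarrow> (\<lambda>j. ?f j x) sums g x"
    "\<And>x. x \<ge> 0 \<Longrightarrow> (g has_field_derivative g' x) (at x within {0..})" by auto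
  have eq: "profile t y = g y" if "y \<ge> 0" for y
    using g(1)[OF that] by (simp add: profile_def sums_iff)
  have sg': "(\<lambda>j. ?f' j x) sums g' x"
    using tendsto_uniform_limitI[OF g'] assms by (auto simp: sums_def)
  have "(\<lambda>j. ?f j (x / t) / t) sums (profile t (x / t) / t)"
    using g(1)[of "x / t"] eq[of "x / t"] assms t by (intro sums_divide) auto
  \<comment> \<open>The recursion matches term \<open>j\<close> at \<open>x / t\<close> with term
    \<open>Suc j\<close> at \<open>x\<close>. The initial term \<open>?f 0 x + ?f' 0 x\<close> left
    over is 0, since \<open>t ^ 0 = 1\<close>.\<close>
  also have "(\<lambda>j. ?f j (x / t) / t) =
      (\<lambda>j. ?f (Suc j) x + ?f' (Suc j) x)"
  proof
    fix j
    have "?f (Suc j) x + ?f' (Suc j) x =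
        - (euler_coeff t (Suc j) * (1 - t ^ Suc j)) / t ^ Suc j * exp (- (x / t ^ Suc j))"
      using t by (simp add: field_simps)
    also have "\<dots> = ?f j (x / t) / t"
      unfolding euler_coeff_Suc using t by simp
    finally show "?f j (x / t) / t = ?f (Suc j) x + ?f' (Suc j) x" ..
  qed
  finally have "(\<lambda>j. ?f j x + ?f' j x) sums (profile t (x / t) / t + (?f 0 x + ?f' 0 x))"
    by (rule sums_Suc)
  moreover have "(\<lambda>j. ?f j x + ?f' j x) sums (profile t x + g' x)"
    using g(1)[OF assms] eq[OF assms] sg' by (intro sums_add) auto
  ultimately have "profile t (x / t) / t = profile t x + g' x"
    by (auto dest: sums_unique2)
  then have "(g has_field_derivative profile t (x / t) / t - profile t x) (at x within {0..})"
    using g(2)[OF assms] by simp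
  then show ?thesis
    by (rule has_field_derivative_transform_within[where d = 1]) (use assms eq in auto)
qed

section \<open>Decay of the profile at infinity and at zero\<close>

lemma profile_bound_exp:
  assumes "x \<ge> 0"
  shows "\<bar>profile t x\<bar> \<le> (\<Sum>j. \<bar>euler_coeff t j\<bar>) * exp (- x)"
proof -
  have "\<bar>profile t x\<bar> \<le> (\<Sum>j. \<bar>euler_coeff t j * exp (- (x / t ^ j))\<bar>)"
    unfolding profile_def using summable_profile[OF assms] by (rule summable_rabs)
  also have "\<dots> \<le> (\<Sum>j. \<bar>euler_coeff t j\<bar> * exp (- x))"
  proof (rule suminf_le)
    fix j
    \<comment> \<open>Every exponent \<open>x / t ^ j\<close> is at least \<open>x\<close>, so
      \<open>exp (- x)\<close> factors out of the whole series.\<close>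
    have "x * t ^ j \<le> x" using assms t by (intro mult_left_le) (auto simp: power_le_one)
    then have "x \<le> x / t ^ j" using t by (simp add: field_simps)
    then show "\<bar>euler_coeff t j * exp (- (x / t ^ j))\<bar> \<le> \<bar>euler_coeff t j\<bar> * exp (- x)"
      by (auto simp: abs_mult intro!: mult_left_mono)
  qed (use summable_profile[OF assms] summable_abs_euler_coeff in \<open>auto intro: summable_mult2\<close>)
  also have "\<dots> = (\<Sum>j. \<bar>euler_coeff t j\<bar>) * exp (- x)"
    by (rule suminf_mult2[symmetric, OF summable_abs_euler_coeff])
  finally show ?thesis .
qed

text \<open>Each use of the pantograph equation, together with \<^prop>\<open>profile t 0 = 0\<close>,
  gains one power of \<open>x\<close>.\<close>
lemma profile_bound_power:
  "\<exists>K\<ge>0. \<forall>x\<ge>0. \<bar>profile t x\<bar> \<le> K * x ^ n"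
proof (induction n)
  case 0
  let ?B = "\<Sum>j. \<bar>euler_coeff t j\<bar>"
  have B: "?B \<ge> 0" by (intro suminf_nonneg summable_abs_euler_coeff) auto
  have "\<bar>profile t x\<bar> \<le> ?B" if "x \<ge> 0" for x
    using profile_bound_exp[OF that] mult_left_le[OF _ B, of "exp (- x)"] that by simp
  with B show ?case by auto
next
  case (Suc n)
  then obtain K where K: "K \<ge> 0" "\<And>x. x \<ge> 0 \<Longrightarrow> \<bar>profile t x\<bar> \<le> K * x ^ n" by auto
  \<comment> \<open>The pantograph equation bounds the derivative at \<open>y\<close> by
    \<open>K * (y / t) ^ n / t + K * y ^ n\<close>, which is \<open>K' * y ^ n\<close>.\<close>
  define K' where "K' = K * (1 / t) ^ n / t + K"
  have K': "K' \<ge> 0" using K t by (simp add: K'_def)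
  have "\<bar>profile t x\<bar> \<le> K' * x ^ Suc n" if x: "x \<ge> 0" for x
  proof -
    have "norm (profile t x - profile t 0) \<le> (K' * x ^ n) * norm (x - 0)"
    proof (rule field_differentiable_bound[where S = "{0..x}"])
      fix y assume y: "y \<in> {0..x}"
      show "(profile t has_field_derivative profile t (y / t) / t - profile t y) (at y within {0..x})"
        by (rule DERIV_subset[OF profile_has_derivative]) (use y in auto)
      have "norm (profile t (y / t) / t - profile t y) \<le> \<bar>profile t (y / t)\<bar> / t + \<bar>profile t y\<bar>"
        using t abs_triangle_ineq4[of "profile t (y / t) / t" "profile t y"] by simp
      also have "\<dots> \<le> K * (y / t) ^ n / t + K * y ^ n"
        using y t by (intro add_mono divide_right_mono K) auto
      also have "\<dots> = K' * y ^ n" by (simp add: K'_def algebra_simps power_divide)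
      also have "\<dots> \<le> K' * x ^ n" using y K' by (intro mult_left_mono power_mono) auto
      finally show "norm (profile t (y / t) / t - profile t y) \<le> K' * x ^ n" .
    qed (use x in auto)
    then show ?thesis using x by (simp add: profile_0 mult_ac)
  qed
  with K' show ?case by blast
qed

text \<open>Nonnegative exponents express flatness at 0, negative ones decay at infinity; the latter
  follows by keeping one term \<open>x ^ k / fact k\<close> of the exponential series.\<close>

lemma profile_bound_powi:
  "\<exists>K\<ge>0. \<forall>x>0. \<bar>profile t x\<bar> \<le> K * x powi n"
proof (cases "n \<ge> 0")
  case True
  then have e: "x powi n = x ^ nat n" for x :: real by (simp add: power_int_def)
  show ?thesis using profile_bound_power[of "nat n"] by (auto simp: e)
next
  case False
  define k where "k = nat (- n)"
  with False have n: "n = - int k" by simp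
  define B where "B = (\<Sum>j. \<bar>euler_coeff t j\<bar>)"
  have B: "B \<ge> 0" unfolding B_def by (intro suminf_nonneg summable_abs_euler_coeff) auto
  have "\<bar>profile t x\<bar> \<le> (B * fact k) * x powi n" if x: "x > 0" for x
  proof -
    have "x ^ k / fact k \<le> exp x"
      using x sum_le_suminf[OF summable_exp_generic[of x], of "{k}"]
      by (simp add: exp_def divide_inverse mult.commute)
    then have "exp (- x) \<le> fact k * x powi n"
      using x by (simp add: n power_int_minus exp_minus field_simps)
    then have "B * exp (- x) \<le> B * (fact k * x powi n)" by (rule mult_left_mono) (rule B)
    with profile_bound_exp[of x] x show ?thesis by (simp add: B_def)
  qed
  with B show ?thesis by (intro exI[of _ "B * fact k"]) auto
qed

section \<open>Scale-invariant moment sums\<close>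

text \<open>Uniformity over a compact interval of positive \<open>y\<close> is what termwise
  differentiation requires.\<close>

lemma weighted_bound:
  assumes "0 < a"
  shows "\<exists>K\<ge>0. \<forall>y\<in>{a..b}. \<forall>l. \<bar>weighted t m (y * t powi l)\<bar> \<le> K * t ^ nat \<bar>l\<bar>"
proof -
  \<comment> \<open>Against the weight \<open>x powi (- m)\<close>, the exponents
    \<open>m + 1\<close> and \<open>m - 1\<close> leave \<open>x\<close> and \<open>1 / x\<close>.
    At \<open>x = y * t powi l\<close> these give the factor \<open>t ^ nat \<bar>l\<bar>\<close>
    for \<open>l \<ge> 0\<close> and \<open>l < 0\<close> respectively.\<close>
  obtain K1 where K1: "K1 \<ge> 0" "\<And>x. x > 0 \<Longrightarrow> \<bar>profile t x\<bar> \<le> K1 * x powi (m + 1)"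
    using profile_bound_powi by metis
  obtain K2 where K2: "K2 \<ge> 0" "\<And>x. x > 0 \<Longrightarrow> \<bar>profile t x\<bar> \<le> K2 * x powi (m - 1)"
    using profile_bound_powi by metis
  have 1: "\<bar>weighted t m x\<bar> \<le> K1 * x" if "x > 0" for x
  proof -
    have "\<bar>weighted t m x\<bar> \<le> x powi (- m) * (K1 * x powi (m + 1))"
      unfolding weighted_def using that K1(2)[OF that] by (simp add: abs_mult mult_left_mono)
    also have "\<dots> = K1 * x" using that by (simp add: power_int_add power_int_minus field_simps)
    finally show ?thesis .
  qed
  have 2: "\<bar>weighted t m x\<bar> \<le> K2 / x" if "x > 0" for x
  proof -
    have "\<bar>weighted t m x\<bar> \<le> x powi (- m) * (K2 * x powi (m - 1))"
      unfolding weighted_def using that K2(2)[OF that] by (simp add: abs_mult mult_left_mono)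
    also have "\<dots> = K2 / x" using that by (simp add: power_int_diff power_int_minus field_simps)
    finally show ?thesis .
  qed
  \<comment> \<open>The absolute value keeps \<open>K\<close> nonnegative when \<open>b\<close> is
    negative and the interval empty.\<close>
  define K where "K = K1 * \<bar>b\<bar> + K2 / a"
  have "\<bar>weighted t m (y * t powi l)\<bar> \<le> K * t ^ nat \<bar>l\<bar>" if y: "y \<in> {a..b}" for y l
  proof (cases "l \<ge> 0")
    case True
    then have tl: "t powi l = t ^ nat \<bar>l\<bar>" by (simp add: power_int_def)
    have "\<bar>weighted t m (y * t powi l)\<bar> \<le> K1 * y * t ^ nat \<bar>l\<bar>"
      using 1[of "y * t powi l"] y assms t by (simp add: tl)
    also have "K1 * y \<le> K1 * \<bar>b\<bar>" using y K1 by (intro mult_left_mono) auto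
    also have "K1 * \<bar>b\<bar> \<le> K" using K2 assms by (simp add: K_def)
    finally show ?thesis using t by (simp add: mult_right_mono)
  next
    case False
    then have tl: "t powi l = 1 / t ^ nat \<bar>l\<bar>" by (simp add: power_int_def field_simps)
    have "\<bar>weighted t m (y * t powi l)\<bar> \<le> K2 / y * t ^ nat \<bar>l\<bar>"
      using 2[of "y * t powi l"] y assms t by (simp add: tl)
    also have "K2 / y \<le> K2 / a" using y K2 assms by (intro divide_left_mono) auto
    also have "K2 / a \<le> K" using K1 by (simp add: K_def)
    finally show ?thesis using t by (simp add: mult_right_mono)
  qed
  moreover have "K \<ge> 0" using K1 K2 assms by (simp add: K_def)
  ultimately show ?thesis by blast
qed

lemma weighted_abs_summable:
  assumes "x > 0"
  shows "(\<lambda>l. \<bar>weighted t m (x * t powi l)\<bar>) summable_on UNIV"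
proof -
  obtain K where K: "\<And>l. \<bar>weighted t m (x * t powi l)\<bar> \<le> K * t ^ nat \<bar>l\<bar>"
    using weighted_bound[OF assms, of x m] by auto
  have "(\<lambda>l. K * t ^ nat \<bar>l\<bar>) summable_on UNIV"
    by (intro summable_on_cmult_right summable_on_int_power_abs t)
  then show ?thesis by (rule summable_on_comparison_test) (use K in auto)
qed

lemma weighted_summable:
  "x > 0 \<Longrightarrow> (\<lambda>l. weighted t m (x * t powi l)) summable_on UNIV"
  by (rule abs_summable_summable) (simp add: weighted_abs_summable)

text \<open>Dividing \<open>x\<close> by \<open>t\<close> merely shifts the summation index by
  one.\<close>

lemma moment_sum_scale: "moment_sum t m (x / t) = moment_sum t m x"
  unfolding moment_sum_def
  by (rule infsum_reindex_bij_witness[where i = "\<lambda>l. l + 1" and j = "\<lambda>l. l - 1"])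
    (use t in \<open>auto simp: power_int_diff\<close>)

text \<open>Product rule and pantograph equation. With the common denominator \<open>x\<close>, the
  chain-rule factor \<open>t powi l\<close> cancels after substituting
  \<open>y * t powi l\<close>.\<close>

lemma weighted_has_derivative:
  assumes "x > 0"
  shows "(weighted t m has_field_derivative
    (- of_int m * weighted t m x + t powi (- m) * weighted t (m - 1) (x / t) - weighted t (m - 1) x) / x) (at x)"
proof -
  have "(profile t has_field_derivative profile t (x / t) / t - profile t x) (at x within {0..})"
    using assms by (intro profile_has_derivative) auto
  then have d: "(profile t has_field_derivative profile t (x / t) / t - profile t x) (at x)"
    using assms by (subst (asm) at_within_interior) auto
  have p: "x powi (- m - 1) = x powi (- m) / x" "x powi (1 - m) = x powi (- m) * x"
     "t powi (1 - m) = t powi (- m) * t"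
    using assms t by (simp_all add: power_int_diff power_int_minus field_simps)
  show ?thesis
    unfolding weighted_def
    by (rule derivative_eq_intros d refl | use assms t in force)+
      (use assms t in \<open>simp add: p power_int_divide_distrib field_simps\<close>)
qed

text \<open>After termwise differentiation the two sums of index \<open>m - 1\<close>, at
  \<open>x / t\<close> and at \<open>x\<close>, agree by scale invariance and merge into the
  coefficient \<open>t powi (- m) - 1\<close>.\<close>

lemma moment_sum_has_derivative:
  assumes x: "x > 0"
  shows "(moment_sum t m has_field_derivative
    (- of_int m * moment_sum t m x + (t powi (- m) - 1) * moment_sum t (m - 1) x) / x) (at x)"
proof -
  let ?N = "\<lambda>l y. - of_int m * weighted t m (y * t powi l)
    + t powi (- m) * weighted t (m - 1) (y / t * t powi l) - weighted t (m - 1) (y * t powi l)"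
  define S where "S = {x / 2 <..< 2 * x}"
  obtain K1 where K1: "K1 \<ge> 0"
    "\<And>y l. y \<in> {x/2..2*x} \<Longrightarrow> \<bar>weighted t m (y * t powi l)\<bar> \<le> K1 * t ^ nat \<bar>l\<bar>"
    using weighted_bound[of "x/2" "2*x" m] x by force
  \<comment> \<open>The interval reaches \<open>2*x/t\<close> because the terms of index
    \<open>m - 1\<close> are evaluated at \<open>y / t\<close> as well as at
    \<open>y\<close>.\<close>
  obtain K2 where K2: "K2 \<ge> 0"
    "\<And>y l. y \<in> {x/2..2*x/t} \<Longrightarrow> \<bar>weighted t (m - 1) (y * t powi l)\<bar> \<le> K2 * t ^ nat \<bar>l\<bar>"
    using weighted_bound[of "x/2" "2*x/t" "m-1"] x by force
  \<comment> \<open>The divisor \<open>x / 2\<close> is the lower bound for \<open>y\<close> on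
    \<open>S\<close>.\<close>
  define C where "C = (\<bar>of_int m\<bar> * K1 + t powi (- m) * K2 + K2) / (x / 2)"
  have "((\<lambda>y. \<Sum>\<^sub>\<infinity>l. weighted t m (y * t powi l)) has_field_derivative (\<Sum>\<^sub>\<infinity>l. ?N l x / x)) (at x)"
  proof (rule has_field_derivative_infsum_int[where S = S and B = "\<lambda>l. C * t ^ nat \<bar>l\<bar>"])
    show "convex S" "open S" "x \<in> S" using x by (auto simp: S_def)
    show "(\<lambda>l. C * t ^ nat \<bar>l\<bar>) summable_on UNIV"
      by (intro summable_on_cmult_right summable_on_int_power_abs t)
    fix l y assume y: "y \<in> S"
    then have y0: "y > 0" using x by (auto simp: S_def)
    then have pos: "y * t powi l > 0" using t by simp
    show "(\<lambda>l. weighted t m (y * t powi l)) summable_on UNIV"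
      by (rule weighted_summable[OF y0])
    have "((\<lambda>y. weighted t m (y * t powi l)) has_field_derivative
        (- of_int m * weighted t m (y * t powi l) + t powi (- m) * weighted t (m - 1) (y * t powi l / t)
          - weighted t (m - 1) (y * t powi l)) / (y * t powi l) * t powi l) (at y)"
      by (rule DERIV_chain2[where f = "weighted t m" and g = "\<lambda>y. y * t powi l",
            OF weighted_has_derivative[OF pos]]) (auto intro!: derivative_eq_intros)
    also have "(- of_int m * weighted t m (y * t powi l) + t powi (- m) * weighted t (m - 1) (y * t powi l / t)
          - weighted t (m - 1) (y * t powi l)) / (y * t powi l) * t powi l = ?N l y / y"
      using t by simp
    finally show "((\<lambda>y. weighted t m (y * t powi l)) has_field_derivative ?N l y / y) (at y)" .
    have "y \<le> y / t" using y0 t by (simp add: field_simps)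
    then have yt: "y \<le> y / t" "y / t \<le> 2 * x / t" "x / 2 \<le> y / t"
      using y t divide_right_mono[of y "2 * x" t] unfolding S_def greaterThanLessThan_iff by linarith+
    have "\<bar>?N l y\<bar> \<le> \<bar>of_int m\<bar> * \<bar>weighted t m (y * t powi l)\<bar>
        + t powi (- m) * \<bar>weighted t (m - 1) (y / t * t powi l)\<bar> + \<bar>weighted t (m - 1) (y * t powi l)\<bar>"
    proof -
      have "\<bar>- a * u + b * v - w\<bar> \<le> \<bar>a\<bar> * \<bar>u\<bar> + b * \<bar>v\<bar> + \<bar>w\<bar>" if "b \<ge> 0" for a b u v w :: real
      proof -
        have "\<bar>b * v\<bar> = b * \<bar>v\<bar>" "\<bar>- a * u\<bar> = \<bar>a\<bar> * \<bar>u\<bar>" using that by (simp_all add: abs_mult)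
        then show ?thesis by linarith
      qed
      then show ?thesis using t by simp
    qed
    also have "\<dots> \<le> \<bar>of_int m\<bar> * (K1 * t ^ nat \<bar>l\<bar>) + t powi (- m) * (K2 * t ^ nat \<bar>l\<bar>) + K2 * t ^ nat \<bar>l\<bar>"
    proof (intro add_mono mult_left_mono K1 K2)
      show "y / t \<in> {x/2..2*x/t}" "y \<in> {x/2..2*x/t}" "y \<in> {x/2..2*x}"
        using yt y unfolding S_def atLeastAtMost_iff greaterThanLessThan_iff by linarith+
    qed (use t in auto)
    also have "\<dots> = (x / 2) * (C * t ^ nat \<bar>l\<bar>)"
      using x by (simp add: C_def field_simps)
    also have "\<dots> \<le> y * (C * t ^ nat \<bar>l\<bar>)"
      using y x K1 K2 t by (intro mult_right_mono) (auto simp: S_def C_def)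
    finally show "\<bar>?N l y / y\<bar> \<le> C * t ^ nat \<bar>l\<bar>" using y0 by (simp add: field_simps)
  qed
  also have "(\<Sum>\<^sub>\<infinity>l. ?N l x / x) =
      (- of_int m * moment_sum t m x + (t powi (- m) - 1) * moment_sum t (m - 1) x) / x"
  proof -
    have h: "((\<lambda>l. weighted t k (y * t powi l)) has_sum moment_sum t k y) UNIV" if "y > 0" for k y
      unfolding moment_sum_def using weighted_summable[OF that] by simp
    have "((\<lambda>l. (- of_int m * weighted t m (x * t powi l)
        + t powi (- m) * weighted t (m - 1) (x / t * t powi l) + (- 1) * weighted t (m - 1) (x * t powi l)) * inverse x)
      has_sum (- of_int m * moment_sum t m x + t powi (- m) * moment_sum t (m - 1) (x / t)
        + (- 1) * moment_sum t (m - 1) x) * inverse x) UNIV"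
      by (intro has_sum_add has_sum_cmult_left has_sum_cmult_right h) (use x t in simp_all)
    then have "((\<lambda>l. ?N l x / x) has_sum (- of_int m * moment_sum t m x
        + (t powi (- m) - 1) * moment_sum t (m - 1) x) / x) UNIV"
      unfolding moment_sum_scale by (simp add: field_simps)
    then show ?thesis by (rule infsumI)
  qed
  finally show ?thesis by (simp add: moment_sum_def[abs_def])
qed

text \<open>Both \<open>m\<close> and \<open>t powi (- m) - 1\<close> vanish at
  \<open>m = 0\<close>, hence so does the derivative.\<close>

lemma moment_sum_0_constant:
  assumes "x > 0" "y > 0"
  shows "moment_sum t 0 x = moment_sum t 0 y"
  using constant_on_pos_reals[OF _ assms, of "moment_sum t 0"] moment_sum_has_derivative[of _ 0] by simp

text \<open>The differential equation for \<open>moment_sum t m\<close> has solutions \<open>a + C x\<^sup>-\<^sup>m\<close>;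
  scale invariance forces \<open>C = 0\<close>.\<close>
lemma moment_sum_step:
  assumes m: "m > 0" and c: "\<And>x. x > 0 \<Longrightarrow> moment_sum t (int m - 1) x = c" and x: "x > 0"
  shows "moment_sum t (int m) x = (t powi (- int m) - 1) / real m * c"
proof -
  define a where "a = (t powi (- int m) - 1) / real m * c"
  \<comment> \<open>With the integrating factor \<open>x ^ m\<close>, \<phi> is the constant
    \<open>C\<close> of the general solution.\<close>
  define \<phi> where "\<phi> x = x ^ m * (moment_sum t (int m) x - a)" for x
  have "(\<phi> has_field_derivative 0) (at y)" if y: "y > 0" for y
  proof -
    have ym: "y ^ m = y ^ (m - 1) * y" using m by (cases m) auto
    have "(t powi (- int m) - 1) * moment_sum t (int m - 1) y = real m * a"
      using y m by (simp add: a_def c)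
    then have d: "(moment_sum t (int m) has_field_derivative real m * (a - moment_sum t (int m) y) / y) (at y)"
      using moment_sum_has_derivative[OF y, of "int m"] by (simp add: algebra_simps)
    show ?thesis
      unfolding \<phi>_def
      by (rule derivative_eq_intros d refl)+ (use y in \<open>simp add: ym field_simps\<close>)
  qed
  then have "\<phi> (x / t) = \<phi> x"
    using x t by (intro constant_on_pos_reals) auto
  then have "(x / t) ^ m * (moment_sum t (int m) x - a) = x ^ m * (moment_sum t (int m) x - a)"
    by (simp add: \<phi>_def moment_sum_scale)
  then have "x ^ m * ((1 - t ^ m) * (moment_sum t (int m) x - a)) = 0"
    using t by (simp add: power_divide field_simps)
  then have "(1 - t ^ m) * (moment_sum t (int m) x - a) = 0"
    using x by simp
  \<comment> \<open>Positivity of \<open>m\<close> makes \<open>1 - t ^ m\<close> nonzero, so it can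
    be cancelled.\<close>
  moreover have "t ^ m < 1" using t m by (simp add: power_Suc_less_one power_less_one_iff)
  ultimately show ?thesis by (simp add: a_def)
qed

text \<open>Iterate \<open>moment_sum_step\<close>: each factor is
  \<open>t powi (- int (Suc m)) * (1 - t ^ Suc m) / real (Suc m)\<close>, and the exponents add up
  by Pascal's rule. The induction varies \<open>x\<close>, since the step needs the previous sum at
  every positive point, while \<open>y\<close> stays fixed.\<close>

lemma moment_sum_eq:
  assumes "x > 0" "y > 0"
  shows "moment_sum t (int m) x =
    t powi (- int ((m + 1) choose 2)) * qpochhammer t t (enat m) / fact m * moment_sum t 0 y"
  using assms(1)
proof (induction m arbitrary: x)
  case 0
  then show ?case using moment_sum_0_constant[OF _ assms(2)]
    by (simp add: qpochhammer_def numeral_2_eq_2)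
next
  case (Suc m)
  let ?c = "t powi (- int ((m + 1) choose 2)) * qpochhammer t t (enat m) / fact m * moment_sum t 0 y"
  have add: "t powi (- int (i + j)) = t powi (- int i) * t powi (- int j)" for i j
    by (simp only: power_int_minus power_int_of_nat power_add inverse_mult_distrib)
  have "moment_sum t (int (Suc m)) x = (t powi (- int (Suc m)) - 1) / real (Suc m) * ?c"
    by (rule moment_sum_step) (use Suc in auto)
  also have "t powi (- int (Suc m)) - 1 = t powi (- int (Suc m)) * (1 - t * t ^ m)"
    using t by (simp add: power_int_minus field_simps del: of_nat_Suc)
  also have "\<dots> / real (Suc m) * ?c =
      (t powi (- int (Suc m)) * t powi (- int ((m + 1) choose 2))) *
      (qpochhammer t t (enat m) * (1 - t * t ^ m)) / (real (Suc m) * fact m) * moment_sum t 0 y"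
    by (simp only: times_divide_eq_left times_divide_eq_right divide_divide_eq_left mult.assoc
        mult.commute mult.left_commute)
  also have "t powi (- int (Suc m)) * t powi (- int ((m + 1) choose 2)) =
      t powi (- int ((Suc m + 1) choose 2))"
    unfolding add[symmetric] by (simp add: numeral_2_eq_2)
  finally show ?case by (simp only: qpochhammer_Suc fact_Suc)
qed

end

section \<open>Moments of the limit law\<close>

theorem proposition7p1:
  fixes t chi :: real and M :: "'a measure" and L :: "'a \<Rightarrow> int" and m :: nat
  assumes "0 < t" and "t < 1" and "chi > 0"
    and "has_limit_law M L t chi"
  shows "integrable M (\<lambda>\<omega>. (inverse chi * t powi (- L \<omega>)) ^ m) \<and>
    (\<integral>\<omega>. (inverse chi * t powi (- L \<omega>)) ^ m \<partial>M) =
      t powi (- int ((m + 1) choose 2)) * qpochhammer t t (enat m) / fact m"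
proof -
  note t = assms(1,2)
  define Q where "Q = qpochhammer t t \<infinity>"
  from assms(4) have M: "prob_space M" and L: "L \<in> measurable M (count_space UNIV)"
    and p: "\<And>l. measure M {\<omega> \<in> space M. L \<omega> = l} = limit_prob t chi l"
    by (auto simp: has_limit_law_def)
  interpret prob_space M by fact
  have eq: "limit_prob t chi l * (inverse chi * t powi (- l)) ^ k =
      weighted t (int k) (chi * t powi l) * inverse Q" for k l
  proof -
    have "(inverse chi * t powi (- l)) ^ k = (chi * t powi l) powi (- int k)"
      using assms by (simp add: power_int_minus power_inverse power_mult_distrib)
    then show ?thesis
      using t by (simp add: limit_prob_eq_profile weighted_def Q_def divide_inverse)
  qed
  have summ: "(\<lambda>l. \<bar>limit_prob t chi l * (inverse chi * t powi (- l)) ^ k\<bar>) summable_on UNIV" for k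
    unfolding eq abs_mult[of _ "inverse Q"]
    by (intro summable_on_cmult_left weighted_abs_summable t assms(3))
  have sum: "(\<Sum>\<^sub>\<infinity>l. limit_prob t chi l * (inverse chi * t powi (- l)) ^ k) =
      moment_sum t (int k) chi * inverse Q" for k
    unfolding eq moment_sum_def
    by (rule infsum_cmult_left) (rule weighted_summable[OF t assms(3)])
  note int = integral_int_valued[OF M L p, where w = "\<lambda>l. (inverse chi * t powi (- l)) ^ k" for k, OF summ]
  \<comment> \<open>The zeroth moment is the total probability, which supplies the normalisation
    without evaluating \<open>Q\<close> or the sum itself.\<close>
  have "moment_sum t 0 chi * inverse Q = 1"
    using int(2)[of 0] sum[of 0] by (simp add: prob_space)
  then show ?thesis
    using int[of m] sum[of m] moment_sum_eq[OF t assms(3,3), of m] by (simp add: mult.assoc)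
qed

end
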